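(* For each of the four continued fractions $K(q)$, $S_1(q)$, $S_2(q)$, $S_3(q)$ defined in the context, there exists an uncountable set of points on the unit circle $\{q\in\mathbb{C}:|q|=1\}$ at which the continued fraction does not converge generally.
   Context: Each continued fraction has the form $1+K_{n=1}^{\infty}\frac{a_n(q)}{1}=1+\cfrac{a_1(q)}{1+\cfrac{a_2(q)}{1+\cdots}}$ with partial numerators as follows. $K(q)$ (Rogers--Ramanujan): $a_n(q)=q^{n}$ for $n\ge1$. $S_1(q)$: $a_{2n-1}(q)=q^{2n-1}$, $a_{2n}(q)=q^{n}+q^{2n}$ for $n\ge1$, i.e. $1+\frac{q}{1}{}_{+}\frac{q+q^2}{1}{}_{+}\frac{q^3}{1}{}_{+}\frac{q^2+q^4}{1}{}_{+}\cdots$. $S_2(q)$: $a_{2n-1}(q)=q^{2n-1}+q^{2(2n-1)}$, $a_{2n}(q)=q^{4n}$ for $n\ge1$, i.e. $1+\frac{q+q^2}{1}{}_{+}\frac{q^4}{1}{}_{+}\frac{q^3+q^6}{1}{}_{+}\frac{q^8}{1}{}_{+}\cdots$. $S_3(q)$: $a_n(q)=q^{n}+q^{2n}$ for $n\ge1$. General convergence. Let $A_n/B_n$ be the $n$-th approximant of a continued fraction $b_0+K_{n=1}^\infty a_n/b_n$, where $A_{-1}=1,B_{-1}=0,A_0=b_0,B_0=1$, $A_n=b_nA_{n-1}+a_nA_{n-2}$, $B_n=b_nB_{n-1}+a_nB_{n-2}$, and let $S_n(w)=\frac{A_n+wA_{n-1}}{B_n+wB_{n-1}}$ for $w\in\hat{\mathbb{C}}$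 (with $S_n(\infty)=A_{n-1}/B_{n-1}$). The chordal metric on $\hat{\mathbb{C}}$ is $d(w,z)=\frac{|z-w|}{\sqrt{1+|w|^2}\sqrt{1+|z|^2}}$ for finite $w,z$ and $d(w,\infty)=1/\sqrt{1+|w|^2}$. The continued fraction converges generally to $f\in\hat{\mathbb{C}}$ if there exist sequences $\{v_n\},\{w_n\}\subset\hat{\mathbb{C}}$ such that $\liminf_n d(v_n,w_n)>0$ and $\lim_n S_n(v_n)=\lim_n S_n(w_n)=f$. It does not converge generally if no such $f$ exists. *)

theory Defs
  imports "HOL-Analysis.Analysis"
begin

text \<open>The extended complex plane with the chordal metric.\<close>

datatype ecomplex = Fin complex | Infty

fun chordal :: "ecomplex \<Rightarrow> ecomplex \<Rightarrow> real" where
  "chordal (Fin w) (Fin z) =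
     norm (z - w) / (sqrt (1 + (norm w)\<^sup>2) * sqrt (1 + (norm z)\<^sup>2))"
| "chordal (Fin w) Infty = 1 / sqrt (1 + (norm w)\<^sup>2)"
| "chordal Infty (Fin z) = 1 / sqrt (1 + (norm z)\<^sup>2)"
| "chordal Infty Infty = 0"

text \<open>
  The quotient \<open>x / y\<close> in the extended plane. The junk value of \<open>0 / 0\<close> is met below only if
  some partial numerator vanishes; for the continued fractions considered here, with
  \<open>norm q = 1\<close>, this forces \<open>q\<close> to be one of the countably many roots of unity.
\<close>

definition ediv :: "complex \<Rightarrow> complex \<Rightarrow> ecomplex" where
  "ediv x y = (if y = 0 then Infty else Fin (x / y))"

text \<open>
  Numerators and denominators of the approximants of \<open>b 0 + K (a n / b n)\<close>, \<open>n \<ge> 1\<close>, with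
  the index shifted by one: \<open>cf_num b a n\<close> and \<open>cf_den b a n\<close> are the usual \<open>A\<close> and \<open>B\<close> with
  index \<open>n - 1\<close>, so that argument \<open>0\<close> gives the initial values at index \<open>-1\<close>.
  The value \<open>a 0\<close> is never used.
\<close>

fun cf_num :: "(nat \<Rightarrow> complex) \<Rightarrow> (nat \<Rightarrow> complex) \<Rightarrow> nat \<Rightarrow> complex" where
  "cf_num b a 0 = 1"
| "cf_num b a (Suc 0) = b 0"
| "cf_num b a (Suc (Suc n)) = b (Suc n) * cf_num b a (Suc n) + a (Suc n) * cf_num b a n"

fun cf_den :: "(nat \<Rightarrow> complex) \<Rightarrow> (nat \<Rightarrow> complex) \<Rightarrow> nat \<Rightarrow> complex" where
  "cf_den b a 0 = 0"
| "cf_den b a (Suc 0) = 1"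
| "cf_den b a (Suc (Suc n)) = b (Suc n) * cf_den b a (Suc n) + a (Suc n) * cf_den b a n"

fun cf_approx :: "(nat \<Rightarrow> complex) \<Rightarrow> (nat \<Rightarrow> complex) \<Rightarrow> nat \<Rightarrow> ecomplex \<Rightarrow> ecomplex" where
  "cf_approx b a n (Fin w) =
     ediv (cf_num b a (Suc n) + w * cf_num b a n) (cf_den b a (Suc n) + w * cf_den b a n)"
| "cf_approx b a n Infty = ediv (cf_num b a n) (cf_den b a n)"

definition converges_generally_to ::
    "(nat \<Rightarrow> complex) \<Rightarrow> (nat \<Rightarrow> complex) \<Rightarrow> ecomplex \<Rightarrow> bool" where
  "converges_generally_to b a f \<longleftrightarrow>
     (\<exists>v w. liminf (\<lambda>n. ereal (chordal (v n) (w n))) > 0 \<and>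
            (\<lambda>n. chordal (cf_approx b a n (v n)) f) \<longlonglongrightarrow> 0 \<and>
            (\<lambda>n. chordal (cf_approx b a n (w n)) f) \<longlonglongrightarrow> 0)"

definition converges_generally :: "(nat \<Rightarrow> complex) \<Rightarrow> (nat \<Rightarrow> complex) \<Rightarrow> bool" where
  "converges_generally b a \<longleftrightarrow> (\<exists>f. converges_generally_to b a f)"

text \<open>
  Partial numerators, as functions of \<open>q\<close> and the index, of the Rogers--Ramanujan continued
  fraction and of the continued fractions \<open>S\<close> with subscript 1, 2, 3.
\<close>

definition K_numer :: "complex \<Rightarrow> nat \<Rightarrow> complex" where
  "K_numer q n = q ^ n"

definition S1_numer :: "complex \<Rightarrow> nat \<Rightarrow> complex" where
  "S1_numer q n = (if odd n then q ^ n else q ^ (n div 2) + q ^ n)"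

definition S2_numer :: "complex \<Rightarrow> nat \<Rightarrow> complex" where
  "S2_numer q n = (if odd n then q ^ n + q ^ (2 * n) else q ^ (2 * n))"

definition S3_numer :: "complex \<Rightarrow> nat \<Rightarrow> complex" where
  "S3_numer q n = q ^ n + q ^ (2 * n)"

end

theory Submission
  imports Defs "HOL-Computational_Algebra.Polynomial" "HOL-Computational_Algebra.Primes"
begin

text \<open>
  Let \<open>q\<close> be a primitive \<open>m\<close>-th root of unity, \<open>m\<close> odd. The partial numerators then have a period
  \<open>L \<in> {m, 2m}\<close>, and since \<open>a (L - n)\<close> is the complex conjugate of \<open>a n\<close>, the matrix of \<open>S\<close> with
  index \<open>L - 1\<close> is determined up to bounded data by its first diagonal entry \<open>\<alpha>\<close>, which is real, and
  one off-diagonal entry \<open>\<beta>\<close>. With \<open>\<tau>\<close> and \<open>\<delta>\<close> the trace and determinant over one period, these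
  satisfy \<open>\<alpha> (\<tau> - \<alpha>) - a L |\<beta>|\<^sup>2 = \<delta>\<close>. As \<open>(\<tau>, \<delta>)\<close> does not depend on \<open>m\<close>, the matrix is
  bounded by a constant independent of \<open>m\<close>.

  By Baire's theorem, a generic point of the unit circle is so close to infinitely many such roots
  that its matrices are bounded, with determinant bounded away from \<open>0\<close>, for infinitely many indices.
  The corresponding Moebius maps do not contract chordal distances by more than a fixed factor, which
  excludes general convergence.
\<close>

subsection \<open>Chordal distance and Moebius maps\<close>

definition wedge :: "complex \<times> complex \<Rightarrow> complex \<times> complex \<Rightarrow> complex" where
  "wedge u v = fst u * snd v - snd u * fst v"

fun homog :: "ecomplex \<Rightarrow> complex \<times> complex" where
  "homog (Fin w) = (w, 1)"
| "homog Infty = (1, 0)"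

lemma homog_nonzero [simp]: "homog w \<noteq> 0"
  by (cases w) (auto simp: zero_prod_def)

text \<open>The chordal distance is the sine of the angle between the complex lines spanned by
  homogeneous coordinates. In this form scaling is irrelevant and the point at infinity is no
  special case.\<close>

lemma chordal_ediv:
  assumes "u \<noteq> 0" "v \<noteq> 0"
  shows "chordal (ediv (fst u) (snd u)) (ediv (fst v) (snd v)) = norm (wedge u v) / (norm u * norm v)"
proof -
  obtain x y where u: "u = (x, y)" by (cases u)
  obtain x' y' where v: "v = (x', y')" by (cases v)
  have s: "sqrt (1 + (norm (x / y))\<^sup>2) = norm (x, y) / norm y" if "y \<noteq> 0" for x y :: complex
  proof -
    have "sqrt (1 + (norm (x / y))\<^sup>2) = sqrt (((norm x)\<^sup>2 + (norm y)\<^sup>2) / (norm y)\<^sup>2)"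
      using that by (simp add: norm_divide power_divide add_divide_distrib add.commute)
    then show ?thesis by (simp add: norm_Pair real_sqrt_divide)
  qed
  have t: "norm (x' / y' - x / y) = norm (wedge u v) / (norm y * norm y')" if "y \<noteq> 0" "y' \<noteq> 0"
  proof -
    have "x' / y' - x / y = - wedge u v / (y * y')"
      using that by (simp add: wedge_def u v field_simps)
    then show ?thesis by (simp add: norm_divide norm_mult)
  qed
  show ?thesis
  proof (cases "y = 0"; cases "y' = 0")
    assume "y \<noteq> 0" "y' \<noteq> 0"
    then show ?thesis using t by (simp add: u v ediv_def s)
  qed (use assms in \<open>auto simp: u v ediv_def s wedge_def norm_Pair norm_mult zero_prod_def\<close>)
qed

lemma ediv_homog [simp]: "ediv (fst (homog w)) (snd (homog w)) = w"
  by (cases w) (auto simp: ediv_def)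

lemma chordal_homog: "chordal v w = norm (wedge (homog v) (homog w)) / (norm (homog v) * norm (homog w))"
  using chordal_ediv[of "homog v" "homog w"] by simp

text \<open>The Pluecker relation in \<open>\<complex>\<^sup>2\<close> gives the triangle inequality.\<close>

lemma chordal_triangle: "chordal u w \<le> chordal u v + chordal w v"
proof -
  define U V W where "U = homog u" and "V = homog v" and "W = homog w"
  have pos: "norm U > 0" "norm V > 0" "norm W > 0" by (simp_all add: U_def V_def W_def)
  have sc: "norm (c * fst x, c * snd x) = norm c * norm x" for c :: complex and x
    by (cases x) (simp add: norm_Pair norm_mult power_mult_distrib distrib_left[symmetric] real_sqrt_mult)
  have "(wedge U W * fst V, wedge U W * snd V)
      = (wedge U V * fst W, wedge U V * snd W) + (- wedge W V * fst U, - wedge W V * snd U)"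
    by (simp add: wedge_def algebra_simps)
  then have "norm (wedge U W) * norm V \<le> norm (wedge U V) * norm W + norm (wedge W V) * norm U"
    by (metis norm_triangle_ineq sc norm_minus_cancel)
  then have "norm (wedge U W) * norm V / (norm U * norm V * norm W)
      \<le> (norm (wedge U V) * norm W + norm (wedge W V) * norm U) / (norm U * norm V * norm W)"
    using pos by (intro divide_right_mono) auto
  then show ?thesis
    using pos by (simp add: chordal_homog flip: U_def V_def W_def) (simp add: field_simps)
qed

text \<open>On homogeneous coordinates the approximant acts as a linear map \<open>M\<close>. It
  multiplies \<open>wedge\<close> by the determinant up to sign, and lengthens a vector by a factor
  of at most \<open>4 * C\<close>; the quotient in \<open>chordal_ediv\<close> is bounded
  accordingly.\<close>

lemma chordal_cf_approx_ge:
  assumes bound: "norm (cf_num b a (Suc n)) \<le> C" "norm (cf_num b a n) \<le> C"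
      "norm (cf_den b a (Suc n)) \<le> C" "norm (cf_den b a n) \<le> C"
    and "norm (cf_num b a (Suc n) * cf_den b a n - cf_num b a n * cf_den b a (Suc n)) \<ge> c"
    and "c > 0"
  shows "chordal (cf_approx b a n v) (cf_approx b a n w) \<ge> c / (4 * C)\<^sup>2 * chordal v w"
proof -
  define A A' B B' where d: "A = cf_num b a (Suc n)" "A' = cf_num b a n"
    "B = cf_den b a (Suc n)" "B' = cf_den b a n"
  define M where "M = (\<lambda>(x, y). (y * A + x * A', y * B + x * B'))"
  have det: "wedge (M u) (M v) = - (A * B' - A' * B) * wedge u v" for u v
    by (cases u; cases v) (simp add: M_def wedge_def algebra_simps)
  have approx: "cf_approx b a n z = ediv (fst (M (homog z))) (snd (M (homog z)))" for z
    by (cases z) (simp_all add: M_def d)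
  have D: "norm (A * B' - A' * B) \<ge> c" using assms by (simp add: d)
  have nz: "M u \<noteq> 0" if "u \<noteq> 0" for u
  proof
    assume "M u = 0"
    then have "wedge u x = 0" for x
      using det[of u x] D \<open>c > 0\<close> by (auto simp: wedge_def)
    from this[of "(0, 1)"] this[of "(1, 0)"] that show False
      by (cases u) (simp add: wedge_def zero_prod_def)
  qed
  have "C \<ge> 0" using bound(1) norm_ge_zero order_trans by blast
  have le: "norm (M u) \<le> 4 * C * norm u" for u
  proof -
    obtain x y where u: "u = (x, y)" by (cases u)
    have xy: "norm x \<le> norm u" "norm y \<le> norm u"
      using norm_fst_le[of x y] norm_snd_le[of y x] by (auto simp: u)
    have *: "norm (y * p + x * r) \<le> 2 * C * norm u" if "norm p \<le> C" "norm r \<le> C" for p r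
    proof -
      have "norm (y * p + x * r) \<le> norm y * norm p + norm x * norm r"
        by (metis norm_mult norm_triangle_ineq)
      also have "\<dots> \<le> norm u * C + norm u * C"
        using that xy by (intro add_mono mult_mono) auto
      finally show ?thesis by simp
    qed
    have "norm (M u) \<le> norm (y * A + x * A') + norm (y * B + x * B')"
      unfolding M_def u by (simp add: norm_Pair_le)
    also have "\<dots> \<le> 2 * C * norm u + 2 * C * norm u"
      using bound by (intro add_mono *) (auto simp: d)
    finally show ?thesis by simp
  qed
  define V W where "V = homog v" and "W = homog w"
  have pos: "norm V > 0" "norm W > 0" "norm (M V) > 0" "norm (M W) > 0"
    using nz by (simp_all add: V_def W_def)
  then have "4 * C * norm V > 0" using le[of V] by linarith
  then have "C > 0" using pos by (simp add: zero_less_mult_iff)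
  have "c / (4 * C)\<^sup>2 * chordal v w = c * norm (wedge V W) / ((4 * C * norm V) * (4 * C * norm W))"
    by (simp add: chordal_homog V_def W_def power2_eq_square)
  also have "\<dots> \<le> norm (wedge (M V) (M W)) / (norm (M V) * norm (M W))"
    using pos D le \<open>c > 0\<close> \<open>C > 0\<close>
    by (intro frac_le mult_mono) (auto simp: det norm_mult norm_minus_commute intro!: mult_right_mono)
  also have "\<dots> = chordal (cf_approx b a n v) (cf_approx b a n w)"
    using pos by (simp add: approx chordal_ediv V_def W_def)
  finally show ?thesis .
qed

text \<open>At infinitely many indices the images of \<open>v n\<close> and \<open>w n\<close> stay
  apart by a fixed multiple of a positive lower bound for their own distance, so they cannot both
  approach \<open>f\<close>.\<close>

lemma not_converges_generally:
  assumes "c > 0"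
    and freq: "\<And>N. \<exists>n\<ge>N. norm (cf_num b a (Suc n)) \<le> C \<and> norm (cf_num b a n) \<le> C
      \<and> norm (cf_den b a (Suc n)) \<le> C \<and> norm (cf_den b a n) \<le> C
      \<and> norm (cf_num b a (Suc n) * cf_den b a n - cf_num b a n * cf_den b a (Suc n)) \<ge> c"
  shows "\<not> converges_generally b a"
proof
  assume "converges_generally b a"
  then obtain f v w where liminf: "liminf (\<lambda>n. ereal (chordal (v n) (w n))) > 0"
    and lim: "(\<lambda>n. chordal (cf_approx b a n (v n)) f) \<longlonglongrightarrow> 0"
      "(\<lambda>n. chordal (cf_approx b a n (w n)) f) \<longlonglongrightarrow> 0"
    unfolding converges_generally_def converges_generally_to_def by blast
  obtain d where d: "0 < ereal d" "ereal d < liminf (\<lambda>n. ereal (chordal (v n) (w n)))"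
    using ereal_dense2[OF liminf] by auto
  have ev: "eventually (\<lambda>n. d < chordal (v n) (w n)) sequentially"
    using less_LiminfD[OF d(2)] by simp
  have "C \<noteq> 0"
  proof
    assume "C = 0"
    then show False using freq[of 0] \<open>c > 0\<close> by auto
  qed
  define e where "e = c / (4 * C)\<^sup>2 * d"
  have "e > 0" using d(1) \<open>c > 0\<close> \<open>C \<noteq> 0\<close> by (simp add: e_def)
  have "(\<lambda>n. chordal (cf_approx b a n (v n)) f + chordal (cf_approx b a n (w n)) f) \<longlonglongrightarrow> 0"
    using tendsto_add[OF lim] by simp
  then have "eventually (\<lambda>n. chordal (cf_approx b a n (v n)) f + chordal (cf_approx b a n (w n)) f < e) sequentially"
    using \<open>e > 0\<close> by (rule order_tendstoD)
  with ev have "eventually (\<lambda>n. d < chordal (v n) (w n) \<and>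
      chordal (cf_approx b a n (v n)) f + chordal (cf_approx b a n (w n)) f < e) sequentially"
    by eventually_elim simp
  then obtain N where N: "\<And>n. n \<ge> N \<Longrightarrow> d < chordal (v n) (w n) \<and>
      chordal (cf_approx b a n (v n)) f + chordal (cf_approx b a n (w n)) f < e"
    by (auto simp: eventually_sequentially)
  from freq[of N] obtain n where n: "n \<ge> N" "norm (cf_num b a (Suc n)) \<le> C" "norm (cf_num b a n) \<le> C"
      "norm (cf_den b a (Suc n)) \<le> C" "norm (cf_den b a n) \<le> C"
      "norm (cf_num b a (Suc n) * cf_den b a n - cf_num b a n * cf_den b a (Suc n)) \<ge> c"
    by blast
  have "e \<le> c / (4 * C)\<^sup>2 * chordal (v n) (w n)"
    unfolding e_def using N[OF n(1)] \<open>c > 0\<close> by (intro mult_left_mono) auto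
  also have "\<dots> \<le> chordal (cf_approx b a n (v n)) (cf_approx b a n (w n))"
    by (rule chordal_cf_approx_ge[OF n(2-6) \<open>c > 0\<close>])
  also have "\<dots> \<le> chordal (cf_approx b a n (v n)) f + chordal (cf_approx b a n (w n)) f"
    by (rule chordal_triangle)
  finally show False using N[OF n(1)] by simp
qed

subsection \<open>Continuants\<close>

text \<open>With this indexing, \<open>continuant a n\<close> involves the \<open>n - 1\<close> numerators \<open>a 1, \<dots>, a (n - 1)\<close>.\<close>

fun continuant :: "(nat \<Rightarrow> 'a :: comm_ring_1) \<Rightarrow> nat \<Rightarrow> 'a" where
  "continuant a 0 = 1"
| "continuant a (Suc 0) = 1"
| "continuant a (Suc (Suc n)) = continuant a (Suc n) + a (Suc n) * continuant a n"

definition shift :: "(nat \<Rightarrow> 'a) \<Rightarrow> nat \<Rightarrow> 'a" where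
  "shift a = (\<lambda>i. a (Suc i))"

lemma continuant_cong: "(\<And>i. 0 < i \<Longrightarrow> i < n \<Longrightarrow> a i = b i) \<Longrightarrow> continuant a n = continuant b n"
  by (induction a n rule: continuant.induct) auto

text \<open>Both sides satisfy the same three-term recurrence in \<open>n\<close>, so two initial
  values decide.\<close>

lemma continuant_left: "continuant a (Suc (Suc n)) = continuant (shift a) (Suc n) + a 1 * continuant (shift (shift a)) n"
proof (induction n rule: induct_nat_012)
  case (ge2 n)
  have "continuant a (Suc (Suc (Suc (Suc n)))) = continuant a (Suc (Suc (Suc n))) + a (Suc (Suc (Suc n))) * continuant a (Suc (Suc n))"
    by (rule continuant.simps(3))
  also have "\<dots> = continuant (shift a) (Suc (Suc (Suc n))) + a 1 * continuant (shift (shift a)) (Suc (Suc n))"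
    unfolding ge2 continuant.simps(3)[of "shift a" "Suc n"] continuant.simps(3)[of "shift (shift a)" n]
    by (simp only: shift_def) (simp only: algebra_simps)
  finally show ?case .
qed (simp_all add: shift_def algebra_simps)

text \<open>Euler's symmetry: expanding the reversed sequence at its left end is the defining
  recurrence of the original at its right end.\<close>

lemma continuant_reverse: "continuant a (Suc n) = continuant (\<lambda>i. a (Suc n - i)) (Suc n)"
proof (induction n arbitrary: a rule: less_induct)
  case (less n)
  consider "n = 0" | "n = 1" | k where "n = Suc (Suc k)"
    by (metis One_nat_def not0_implies_Suc)
  then show ?case
  proof cases
    case (3 k)
    define b where "b = (\<lambda>i. a (Suc n - i))"
    have "continuant b (Suc n) = continuant (shift b) (Suc (Suc k)) + b 1 * continuant (shift (shift b)) (Suc k)"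
      unfolding 3 by (rule continuant_left)
    also have "shift b = (\<lambda>i. a (Suc (Suc k) - i))"
      by (simp add: b_def shift_def 3)
    also have "shift (\<lambda>i. a (Suc (Suc k) - i)) = (\<lambda>i. a (Suc k - i))"
      by (simp add: shift_def)
    also have "continuant (\<lambda>i. a (Suc (Suc k) - i)) (Suc (Suc k)) = continuant a (Suc (Suc k))"
      by (rule less[symmetric]) (simp add: 3)
    also have "continuant (\<lambda>i. a (Suc k - i)) (Suc k) = continuant a (Suc k)"
      by (rule less[symmetric]) (simp add: 3)
    finally show ?thesis by (simp add: 3 b_def)
  qed auto
qed

lemma cnj_continuant: "cnj (continuant a n) = continuant (\<lambda>i. cnj (a i)) n"
  by (induction a n rule: continuant.induct) auto

lemma poly_continuant: "poly (continuant p n) z = continuant (\<lambda>i. poly (p i) z) n"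
  by (induction p n rule: continuant.induct) auto

text \<open>A continuant is a sum of products of entries no two of which are adjacent; among
  \<open>n - 1\<close> indices at most \<open>n div 2\<close> can be chosen.\<close>

lemma degree_continuant_le:
  fixes p :: "nat \<Rightarrow> 'a :: comm_ring_1 poly"
  assumes "\<And>i. degree (p i) \<le> d"
  shows "degree (continuant p n) \<le> d * (n div 2)"
  using assms
proof (induction p n rule: continuant.induct)
  case (3 p n)
  have "degree (p (Suc n) * continuant p n) \<le> d + d * (n div 2)"
    using degree_mult_le[of "p (Suc n)" "continuant p n"] 3 by (meson add_mono order_trans)
  moreover have "degree (continuant p (Suc n)) \<le> d * (Suc n div 2)" using 3 by blast
  moreover have "d * (Suc n div 2) \<le> d + d * (n div 2)"
    by (metis add.commute mult_Suc_right mult_le_mono2 div_le_mono add_2_eq_Suc' div_add_self2 le_SucI order_refl zero_neq_numeral Suc_eq_plus1)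
  ultimately show ?case by (simp add: degree_add_le)
qed auto

lemma cf_num_eq_continuant: "cf_num (\<lambda>_. 1) a n = continuant a n"
  by (induction a n rule: continuant.induct) auto

lemma cf_den_eq_continuant: "cf_den (\<lambda>_. 1) a (Suc n) = continuant (shift a) n"
  by (induction a n rule: continuant.induct) (auto simp: shift_def)

lemma cf_wronskian:
  "cf_num b a (Suc n) * cf_den b a n - cf_num b a n * cf_den b a (Suc n) = - (\<Prod>i = 1..n. - a i)"
proof (induction n)
  case (Suc n)
  have "cf_num b a (Suc (Suc n)) * cf_den b a (Suc n) - cf_num b a (Suc n) * cf_den b a (Suc (Suc n))
      = - a (Suc n) * (cf_num b a (Suc n) * cf_den b a n - cf_num b a n * cf_den b a (Suc n))"
    by (simp add: algebra_simps)
  then show ?case unfolding Suc by simp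
qed simp

text \<open>For \<open>L \<ge> 2\<close> this is the trace of the monodromy matrix carrying
  \<open>(F 0, F 1)\<close> to \<open>(F L, F (Suc L))\<close> for solutions of F(n+2) = F(n+1) +
  a(n+1) F(n). Continuants make it available over polynomial rings as well.\<close>

definition period_trace :: "(nat \<Rightarrow> 'a :: comm_ring_1) \<Rightarrow> nat \<Rightarrow> 'a" where
  "period_trace a L = continuant a L + a L * continuant (shift a) (L - 2)"

text \<open>Cyclic invariance of the trace: expanding \<open>continuant (shift a) L\<close> at the
  right end and \<open>continuant a L\<close> at the left end leaves the same three terms on both
  sides.\<close>

lemma period_trace_shift:
  assumes "L \<ge> 2" "a (Suc L) = a 1"
  shows "period_trace (shift a) L = period_trace a L"
proof -
  obtain k where L: "L = Suc (Suc k)" using assms(1) by (intro that[of "L - 2"]) simp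
  show ?thesis using assms(2) continuant_left[of a k] by (simp add: L period_trace_def shift_def)
qed

text \<open>The two combinations are the basis of solutions with initial values (1, 0) and (0,
  1).\<close>

lemma solution_eq:
  fixes F :: "nat \<Rightarrow> complex"
  assumes "\<And>n. F (Suc (Suc n)) = F (Suc n) + a (Suc n) * F n"
  shows "F n = F 0 * (cf_num (\<lambda>_. 1) a n - cf_den (\<lambda>_. 1) a n) + F 1 * cf_den (\<lambda>_. 1) a n"
proof (induction n rule: induct_nat_012)
  case (ge2 n)
  show ?case unfolding assms[of n] ge2(2) by (subst ge2(1)) (simp add: algebra_simps)
qed auto

section \<open>Monodromy and multipliers of periodic recurrences\<close>

lemma period_trace_eq:
  assumes "L \<ge> 2"
  shows "period_trace a L = cf_num (\<lambda>_. 1) a L - cf_den (\<lambda>_. 1) a L + cf_den (\<lambda>_. 1) a (Suc L)"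
proof -
  obtain k where L: "L = Suc (Suc k)" using assms(1) by (intro that[of "L - 2"]) simp
  show ?thesis
    by (simp add: L period_trace_def cf_num_eq_continuant flip: cf_den_eq_continuant)
qed

lemma period_det_eq:
  "(cf_num (\<lambda>_. 1) a L - cf_den (\<lambda>_. 1) a L) * cf_den (\<lambda>_. 1) a (Suc L)
    - cf_den (\<lambda>_. 1) a L * (cf_num (\<lambda>_. 1) a (Suc L) - cf_den (\<lambda>_. 1) a (Suc L)) = (\<Prod>i = 1..L. - a i)"
  using cf_wronskian[of "\<lambda>_. 1" a L] by (simp add: algebra_simps)

text \<open>The vector \<open>(F 0, F 1)\<close> is an eigenvector of the monodromy matrix.
  Exhibiting solutions with known multipliers therefore gives equations for trace and
  determinant.\<close>

lemma multiplier_char_eq: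
  fixes F :: "nat \<Rightarrow> complex"
  assumes F: "\<And>n. F (Suc (Suc n)) = F (Suc n) + a (Suc n) * F n"
    and "L \<ge> 2" "F L = \<mu> * F 0" "F (Suc L) = \<mu> * F 1" "F 0 \<noteq> 0 \<or> F 1 \<noteq> 0"
  shows "\<mu>\<^sup>2 - period_trace a L * \<mu> + (\<Prod>i = 1..L. - a i) = 0"
proof -
  define p r s u where "p = cf_num (\<lambda>_. 1) a L - cf_den (\<lambda>_. 1) a L" and "r = cf_den (\<lambda>_. 1) a L"
    and "s = cf_num (\<lambda>_. 1) a (Suc L) - cf_den (\<lambda>_. 1) a (Suc L)" and "u = cf_den (\<lambda>_. 1) a (Suc L)"
  have "\<mu> * F 0 = F 0 * p + F 1 * r" "\<mu> * F 1 = F 0 * s + F 1 * u"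
    using solution_eq[of F a L, OF F] solution_eq[of F a "Suc L", OF F] assms(3,4)
    unfolding p_def r_def s_def u_def by auto
  then have "F 0 * (\<mu>\<^sup>2 - (p + u) * \<mu> + (p * u - r * s)) = 0" "F 1 * (\<mu>\<^sup>2 - (p + u) * \<mu> + (p * u - r * s)) = 0"
    by algebra+
  then have "\<mu>\<^sup>2 - (p + u) * \<mu> + (p * u - r * s) = 0" using assms(5) by auto
  then show ?thesis
    using period_det_eq[of a L] period_trace_eq[OF assms(2), of a] by (simp add: p_def r_def s_def u_def)
qed

lemma eigenvector_2x2:
  fixes p r s u \<mu> :: "'a :: field"
  assumes "(p - \<mu>) * (u - \<mu>) = r * s"
  obtains x y where "x \<noteq> 0 \<or> y \<noteq> 0" "p * x + r * y = \<mu> * x" "s * x + u * y = \<mu> * y"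
proof (cases "r = 0")
  case False
  have "s * r + u * (\<mu> - p) = \<mu> * (\<mu> - p)" using assms by algebra
  then show thesis using that[of r "\<mu> - p"] False by (simp add: algebra_simps)
next
  case True
  show thesis
  proof (cases "u = \<mu>")
    case True
    then show thesis using that[of 0 1] \<open>r = 0\<close> by simp
  next
    case False
    then have "p = \<mu>" using assms \<open>r = 0\<close> by simp
    then show thesis using that[of 1 "s / (\<mu> - u)"] \<open>r = 0\<close> False by (simp add: field_simps)
  qed
qed

text \<open>An eigenvector of the monodromy matrix serves as initial data; periodicity of
  \<open>a\<close> spreads the relation from the indices 0 and 1 to all others.\<close>

lemma solution_with_multiplier:
  fixes a :: "nat \<Rightarrow> complex"
  assumes "L \<ge> 2" and per: "\<And>n. a (n + L) = a n"
    and "\<mu>\<^sup>2 - period_trace a L * \<mu> + (\<Prod>i = 1..L. - a i) = 0"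
  obtains F where "\<And>n. F (Suc (Suc n)) = F (Suc n) + a (Suc n) * F n"
    "\<And>n. F (n + L) = \<mu> * F n" "F 0 \<noteq> 0 \<or> F 1 \<noteq> 0"
proof -
  define p r s u where "p = cf_num (\<lambda>_. 1) a L - cf_den (\<lambda>_. 1) a L" and "r = cf_den (\<lambda>_. 1) a L"
    and "s = cf_num (\<lambda>_. 1) a (Suc L) - cf_den (\<lambda>_. 1) a (Suc L)" and "u = cf_den (\<lambda>_. 1) a (Suc L)"
  have "\<mu>\<^sup>2 - (p + u) * \<mu> + (p * u - r * s) = 0"
    using assms(3) period_det_eq[of a L] period_trace_eq[OF assms(1), of a]
    by (simp add: p_def r_def s_def u_def)
  then have "(p - \<mu>) * (u - \<mu>) = r * s" by algebra
  then obtain x y where xy: "x \<noteq> 0 \<or> y \<noteq> 0" "p * x + r * y = \<mu> * x" "s * x + u * y = \<mu> * y"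
    by (rule eigenvector_2x2)
  define F where "F n = x * (cf_num (\<lambda>_. 1) a n - cf_den (\<lambda>_. 1) a n) + y * cf_den (\<lambda>_. 1) a n" for n
  have rec: "F (Suc (Suc n)) = F (Suc n) + a (Suc n) * F n" for n
    by (simp add: F_def algebra_simps)
  have 0: "F 0 = x" "F 1 = y" by (simp_all add: F_def)
  have "F (n + L) = \<mu> * F n" for n
  proof (induction n rule: induct_nat_012)
    case (ge2 n)
    then show ?case using per[of "Suc n"] by (simp add: rec algebra_simps)
  next
    case 0 show ?case unfolding add_0 0 using xy(2) by (simp add: F_def p_def r_def mult.commute)
  next
    case 1 show ?case using 0(2) xy(3) by (simp add: F_def s_def u_def mult.commute del: cf_num.simps cf_den.simps)
  qed
  then show thesis using that[of F] rec xy(1) 0 by blast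
qed

text \<open>Compare coefficients of p(qz) and p(z). For a primitive \<open>m\<close>-th root this
  removes every coefficient strictly between 0 and \<open>m\<close>.\<close>

lemma invariant_poly_coeff:
  fixes p :: "'a :: field_char_0 poly"
  assumes "\<And>z. poly p (q * z) = poly p z" "q ^ j \<noteq> 1"
  shows "coeff p j = 0"
proof -
  have "pcompose p [:0, q:] = p"
    by (subst poly_eq_poly_eq_iff[symmetric]) (auto simp: poly_pcompose assms(1) mult.commute[of _ q])
  then have "q ^ j * coeff p j = coeff p j" by (metis coeff_pcompose_linear)
  then show ?thesis using assms(2) by simp
qed

subsection \<open>Trace and determinant at roots of unity\<close>

definition primitive_root :: "nat \<Rightarrow> complex \<Rightarrow> bool" where
  "primitive_root m q \<longleftrightarrow> q ^ m = 1 \<and> (\<forall>j. 0 < j \<and> j < m \<longrightarrow> q ^ j \<noteq> 1)"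

lemma primitive_rootD: "primitive_root m q \<Longrightarrow> q ^ m = 1"
  by (simp add: primitive_root_def)

lemma prod_power_roots:
  assumes "primitive_root m q" "odd m"
  shows "(\<Prod>i = 1..m. q ^ i) = 1"
proof -
  obtain k where k: "m = 2 * k + 1" using assms(2) by (elim oddE)
  have "(\<Prod>i = 1..m. q ^ i) = q ^ (\<Sum>i = 1..m. i)" by (simp add: power_sum)
  also have "(\<Sum>i = 1..m. i) = m * (k + 1)" using gauss_sum_from_Suc_0[where ?'a = nat, of m] by (simp add: k)
  finally show ?thesis using primitive_rootD[OF assms(1)] by (simp only: power_mult power_one)
qed

text \<open>Replacing z by qz permutes the factors, so the product, of degree at most
  \<open>m\<close>, has the form 1 + c z^m. The factor with \<open>i = m\<close> vanishes at z = -1,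
  which gives c = 1 for odd \<open>m\<close>.\<close>

lemma prod_one_plus_roots:
  assumes "primitive_root m q" "odd m"
  shows "(\<Prod>i = 1..m. 1 + z * q ^ i) = 1 + z ^ m"
proof -
  note q = primitive_rootD[OF assms(1)]
  have "m > 0" using assms(2) by (auto intro!: Nat.gr0I)
  define p where "p = (\<Prod>i = 1..m. [:1, q ^ i:])"
  have p: "poly p z = (\<Prod>i = 1..m. 1 + z * q ^ i)" for z
    by (simp add: p_def poly_prod)
  have "poly p (q * z) = poly p z" for z
  proof -
    define f where "f i = 1 + z * q ^ i" for i
    have "poly p (q * z) = (\<Prod>i = 1..m. f (Suc i))" by (simp add: p f_def mult_ac)
    also have "\<dots> = (\<Prod>i = Suc 1..Suc m. f i)" by (rule prod.shift_bounds_cl_Suc_ivl[symmetric])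
    also have "\<dots> = (\<Prod>i = Suc 1..m. f i) * f (Suc m)" using \<open>m > 0\<close> by simp
    also have "f (Suc m) = f 1" by (simp add: f_def q)
    also have "(\<Prod>i = Suc 1..m. f i) * f 1 = (\<Prod>i = 1..m. f i)"
      using \<open>m > 0\<close> by (simp add: prod.atLeast_Suc_atMost mult.commute)
    finally show ?thesis by (simp add: p f_def)
  qed
  then have c: "coeff p j = 0" if "0 < j" "j < m" for j
    using assms(1) that invariant_poly_coeff unfolding primitive_root_def by blast
  have "degree p \<le> (\<Sum>i = 1..m. degree [:1, q ^ i:])"
    unfolding p_def by (rule degree_prod_sum_le[OF finite_atLeastAtMost, unfolded comp_def])
  also have "\<dots> \<le> (\<Sum>i = 1..m. 1)" by (intro sum_mono) auto
  finally have "degree p \<le> m" by simp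
  have "p = [:1:] + monom (coeff p m) m"
  proof (rule poly_eqI)
    fix j
    have "coeff p 0 = 1" using p[of 0] by (simp add: poly_0_coeff_0)
    moreover have "coeff p j = 0" if "j > m" using \<open>degree p \<le> m\<close> that by (simp add: coeff_eq_0)
    ultimately show "coeff p j = coeff ([:1:] + monom (coeff p m) m) j"
      using c[of j] \<open>m > 0\<close> by (cases "j = 0"; cases "j < m"; cases "j = m") (auto simp: coeff_pCons split: nat.splits)
  qed
  then have *: "poly p z = 1 + coeff p m * z ^ m" for z
    by (metis poly_add poly_monom poly_pCons poly_0 mult_zero_right add.right_neutral)
  have "poly p (- 1) = 0" using q \<open>m > 0\<close> by (auto simp: p)
  then have "coeff p m = 1" using *[of "-1"] assms(2) by simp
  then show ?thesis using *[of z] by (simp add: p)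
qed

text \<open>
  As a polynomial in \<open>z\<close> the trace has degree less than \<open>m\<close>, and \<open>z \<mapsto> q z\<close> merely shifts the
  sequence cyclically; hence the trace is constant.
\<close>

lemma period_trace_roots:
  assumes "primitive_root m q" "odd m" "m \<ge> 2"
  shows "period_trace (\<lambda>i. z * q ^ i + c * z\<^sup>2 * q ^ (2 * i)) m = 1"
proof -
  define p where "p i = [:0, q ^ i, c * q ^ (2 * i):]" for i
  define t where "t = period_trace p m"
  have ev: "poly t z = period_trace (\<lambda>i. z * q ^ i + c * z\<^sup>2 * q ^ (2 * i)) m" for z
    by (simp add: t_def period_trace_def poly_continuant shift_def p_def algebra_simps power2_eq_square)
  have "poly t (q * z) = poly t z" for z
  proof -
    define a where "a = (\<lambda>i. z * q ^ i + c * z\<^sup>2 * q ^ (2 * i))"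
    have "poly t (q * z) = period_trace (shift a) m"
      unfolding ev by (simp add: a_def shift_def algebra_simps power2_eq_square)
    also have "\<dots> = period_trace a m"
    proof (rule period_trace_shift[OF assms(3)])
      have "q ^ (2 * Suc m) = q ^ m * q ^ m * q\<^sup>2" by (simp add: power2_eq_square mult_2 power_add)
      then show "a (Suc m) = a 1" using primitive_rootD[OF assms(1)] by (simp add: a_def)
    qed
    finally show ?thesis by (simp only: ev[of z] a_def)
  qed
  then have c: "coeff t j = 0" if "0 < j" "j < m" for j
    using assms(1) that invariant_poly_coeff unfolding primitive_root_def by blast
  obtain k where k: "m = 2 * k + 1" using assms(2) by (elim oddE)
  have d: "degree (p i) \<le> 2" for i by (simp add: p_def)
  \<comment> \<open>Since \<open>m = 2 * k + 1\<close>, rounding in the degree bound keeps both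
    summands of the trace at degree at most \<open>m - 1\<close>, even though the entries are
    quadratic.\<close>
  have "degree (continuant p m) \<le> 2 * k" using degree_continuant_le[of p 2 m] d by (simp add: k)
  moreover have "degree (p m * continuant (shift p) (m - 2)) \<le> 2 + 2 * ((m - 2) div 2)"
    using degree_mult_le[of "p m" "continuant (shift p) (m - 2)"] degree_continuant_le[of "shift p" 2 "m - 2"] d
    by (smt (verit) add_mono order_trans shift_def)
  moreover have "2 + 2 * ((m - 2) div 2) \<le> 2 * k" using assms(3) by (simp add: k)
  ultimately have "degree t \<le> 2 * k" unfolding t_def period_trace_def by (intro degree_add_le) auto
  then have "t = [:coeff t 0:]"
    using c by (intro poly_eqI) (metis k Suc_eq_plus1 coeff_eq_0 coeff_pCons_0 coeff_pCons_Suc coeff_0 le_imp_less_Suc not0_implies_Suc not_less order.strict_trans1 zero_less_Suc)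
  then have "poly t z = poly t 0" by (metis poly_pCons poly_0 mult_zero_right)
  moreover have "continuant (\<lambda>_. 0 :: complex) n = 1" for n
    by (induction n rule: induct_nat_012) auto
  then have "poly t 0 = 1" by (simp add: ev period_trace_def shift_def)
  ultimately show ?thesis by (simp add: ev)
qed

text \<open>Each numerator factors as z q^i (1 + c z q^i), so \<open>prod_power_roots\<close> and
  \<open>prod_one_plus_roots\<close> apply.\<close>

lemma period_det_roots:
  assumes "primitive_root m q" "odd m"
  shows "(\<Prod>i = 1..m. - (z * q ^ i + c * z\<^sup>2 * q ^ (2 * i))) = - (z ^ m) * (1 + (c * z) ^ m)"
proof -
  have "(\<Prod>i = 1..m. - (z * q ^ i + c * z\<^sup>2 * q ^ (2 * i))) = (\<Prod>i = 1..m. (- z) * q ^ i * (1 + c * z * q ^ i))"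
    by (intro prod.cong) (auto simp: algebra_simps power2_eq_square mult_2 mult_2_right power_add)
  also have "\<dots> = (- z) ^ m * (\<Prod>i = 1..m. q ^ i) * (\<Prod>i = 1..m. 1 + c * z * q ^ i)"
    by (simp only: prod.distrib prod_constant card_atLeastAtMost) simp
  finally show ?thesis
    unfolding prod_power_roots[OF assms] prod_one_plus_roots[OF assms] using assms(2) by simp
qed

text \<open>Reversing continuants turns the symmetry of \<open>a\<close> into conjugation: the first
  entry is a real \<open>x\<close> and the off-diagonal entries are conjugate. In
  \<open>c * (norm \<beta>)\<^sup>2 = x * (\<tau> - x) - \<delta>\<close> the left side is
  nonnegative and the right side is a concave quadratic in \<open>x\<close>, which bounds both
  unknowns.\<close>

lemma period_bounded:
  fixes a :: "nat \<Rightarrow> complex" and c \<tau> \<delta> :: real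
  assumes "L \<ge> 3" and sym: "\<And>n. 0 < n \<Longrightarrow> n < L \<Longrightarrow> a (L - n) = cnj (a n)"
    and aL: "a L = of_real c" "1 \<le> c"
    and tr: "period_trace a L = of_real \<tau>" "\<bar>\<tau>\<bar> \<le> 4"
    and det: "(\<Prod>i = 1..L. - a i) = of_real \<delta>" "c \<le> \<bar>\<delta>\<bar>" "\<bar>\<delta>\<bar> \<le> 2"
  shows "norm (continuant a L) \<le> 9 \<and> norm (continuant a (L - 1)) \<le> 9 \<and> norm (continuant (shift a) (L - 1)) \<le> 9
    \<and> norm (continuant (shift a) (L - 2)) \<le> 9 \<and> norm (\<Prod>i = 1..L-1. - a i) \<ge> 1"
proof -
  obtain k where L: "L = Suc (Suc (Suc k))" 
    using assms(1) by (intro that[of "L - 3"]) simp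
  define \<alpha> \<beta> \<gamma> where "\<alpha> = continuant a L" and "\<beta> = continuant a (L - 1)" and "\<gamma> = continuant (shift a) (L - 2)"
  have "cnj \<alpha> = continuant (\<lambda>i. a (L - i)) L"
    unfolding \<alpha>_def cnj_continuant by (rule continuant_cong) (simp add: sym)
  also have "\<dots> = \<alpha>" unfolding \<alpha>_def L by (rule continuant_reverse[symmetric])
  finally have "\<alpha> \<in> \<real>" by (simp add: Reals_cnj_iff)
  then obtain x where x: "\<alpha> = of_real x" by (elim Reals_cases)
  have "cnj \<beta> = continuant (\<lambda>i. a (L - i)) (L - 1)"
    unfolding \<beta>_def cnj_continuant by (rule continuant_cong) (simp add: sym)
  \<comment> \<open>With \<open>L - 1\<close> in place of \<open>L\<close> the reversed entries run
    from \<open>a (L - 1)\<close> down to \<open>a 2\<close>, hence the shifted sequence.\<close>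
  also have "\<dots> = continuant (\<lambda>i. shift a (Suc (Suc k) - i)) (Suc (Suc k))"
    unfolding L by (simp add: shift_def, intro continuant_cong arg_cong2[where f = "(+)"] refl arg_cong2[where f = "(*)"] arg_cong[where f = a]) auto
  also have "\<dots> = continuant (shift a) (L - 1)" unfolding L by (simp only: continuant_reverse[symmetric] diff_Suc_1)
  finally have \<beta>: "continuant (shift a) (L - 1) = cnj \<beta>" by simp
  have W: "\<alpha> * \<gamma> - \<beta> * cnj \<beta> = - (\<Prod>i = 1..L-1. - a i)"
    using cf_wronskian[of "\<lambda>_. 1" a "L - 1"] \<beta>
    by (simp add: L \<alpha>_def \<beta>_def \<gamma>_def cf_num_eq_continuant cf_den_eq_continuant del: cf_num.simps cf_den.simps continuant.simps)
  have P: "of_real c * (\<Prod>i = 1..L-1. - a i) = - of_real \<delta>"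
    unfolding det(1)[symmetric] by (simp add: L aL(1)[unfolded L] mult.commute)
  have tr': "of_real c * \<gamma> = of_real (\<tau> - x)"
    using tr(1) by (simp add: period_trace_def aL x[symmetric] \<alpha>_def \<gamma>_def algebra_simps)
  have "complex_of_real (x * (\<tau> - x) - c * (norm \<beta>)\<^sup>2) = of_real x * of_real (\<tau> - x) - of_real c * (\<beta> * cnj \<beta>)"
    by (simp only: of_real_diff of_real_mult complex_norm_square)
  also have "\<dots> = complex_of_real c * (\<alpha> * \<gamma> - \<beta> * cnj \<beta>)"
    unfolding tr'[symmetric] x by (simp add: algebra_simps)
  also have "\<dots> = of_real \<delta>" using P W by simp
  finally have eq: "c * (norm \<beta>)\<^sup>2 = x * (\<tau> - x) - \<delta>" by (simp only: of_real_eq_iff)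
  have "(norm \<beta>)\<^sup>2 \<le> c * (norm \<beta>)\<^sup>2" using aL(2) mult_right_mono[of 1 c "(norm \<beta>)\<^sup>2"] by simp
  have q: "x * (\<tau> - x) \<le> 4 * \<bar>x\<bar> - x\<^sup>2"
  proof -
    have "x * \<tau> \<le> \<bar>x\<bar> * 4" using tr(2) by (metis abs_ge_self abs_mult mult_left_mono order_trans abs_ge_zero)
    then show ?thesis by (simp add: algebra_simps power2_eq_square)
  qed
  have "0 \<le> c * (norm \<beta>)\<^sup>2" using aL(2) by simp
  then have "(\<bar>x\<bar> - 2)\<^sup>2 \<le> 6" using q eq det(3) by (simp add: power2_eq_square algebra_simps)
  also have "(6::real) \<le> 3\<^sup>2" by simp
  finally have x5: "\<bar>x\<bar> \<le> 5" using abs_le_square_iff[of "\<bar>x\<bar> - 2" 3] by simp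
  have "(norm \<beta>)\<^sup>2 \<le> 4 * \<bar>x\<bar> - x\<^sup>2 + 2" using \<open>(norm \<beta>)\<^sup>2 \<le> c * (norm \<beta>)\<^sup>2\<close> eq q det(3) by linarith
  also have "\<dots> \<le> 9\<^sup>2" using sum_squares_ge_zero[of "\<bar>x\<bar> - 2" 0] by (simp add: power2_eq_square algebra_simps)
  finally have b: "norm \<beta> \<le> 9" by (rule power2_le_imp_le) simp
  \<comment> \<open>The constant 9 arises here, as the sum of the bounds 5 for \<open>x\<close> and
    4 for \<open>\<tau>\<close>.\<close>
  have "norm (of_real c * \<gamma>) \<le> 9" unfolding tr' norm_of_real using x5 tr(2) by linarith
  then have g: "norm \<gamma> \<le> 9" using aL(2) mult_right_mono[of 1 c "norm \<gamma>"] by (simp add: norm_mult)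
  have "c * norm (\<Prod>i = 1..L-1. - a i) = \<bar>\<delta>\<bar>"
    using arg_cong[OF P, of norm] aL(2) by (simp only: norm_mult norm_minus_cancel norm_of_real abs_of_nonneg)
  then have "c * 1 \<le> c * norm (\<Prod>i = 1..L-1. - a i)" using det(2) by simp
  then have "norm (\<Prod>i = 1..L-1. - a i) \<ge> 1" using aL(2) by (simp only: mult_le_cancel_left_pos)
  then show ?thesis using b g x5 \<beta> x by (simp add: \<alpha>_def \<beta>_def \<gamma>_def)
qed

section \<open>Cyclic sums and the discrete Fourier transform\<close>

lemma sum_cyclic_shift:
  fixes f :: "nat \<Rightarrow> 'a :: ab_group_add"
  assumes "\<And>k. f (k + m) = f k"
  shows "(\<Sum>k<m. f (Suc k)) = (\<Sum>k<m. f k)"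
proof -
  have "(\<Sum>k<Suc m. f k) = f 0 + (\<Sum>k<m. f (Suc k))" by (rule sum.lessThan_Suc_shift)
  moreover have "f m = f 0" using assms[of 0] by simp
  ultimately show ?thesis by (simp add: add.commute)
qed

lemma primitive_root_inverse: "primitive_root m q \<Longrightarrow> primitive_root m (inverse q)"
  by (simp add: primitive_root_def power_inverse)

lemma primitive_root_nonzero: "primitive_root m q \<Longrightarrow> m > 0 \<Longrightarrow> q \<noteq> 0"
  by (auto simp: primitive_root_def power_0_left)

text \<open>If m < 2j < 2m, then q^(2j) = 1 would give the exponent 2j - m, which lies strictly
  between 0 and \<open>m\<close>.\<close>

lemma primitive_root_square:
  assumes "primitive_root m q" "odd m"
  shows "primitive_root m (q\<^sup>2)"
  unfolding primitive_root_def
proof (intro conjI allI impI notI)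
  show "(q\<^sup>2) ^ m = 1"
    using primitive_rootD[OF assms(1)] by (metis power_mult mult.commute power_one)
next
  fix j assume j: "0 < j \<and> j < m" "(q\<^sup>2) ^ j = 1"
  then have q: "q ^ (2 * j) = 1" by (simp add: power_mult)
  have no: "q ^ i \<noteq> 1" if "0 < i" "i < m" for i using assms(1) that by (simp add: primitive_root_def)
  show False
  proof (cases "2 * j < m")
    case True
    then show False using no[of "2 * j"] q j by simp
  next
    case False
    moreover have "2 * j \<noteq> m" using assms(2) by auto
    ultimately have "2 * j = m + (2 * j - m)" "0 < 2 * j - m" "2 * j - m < m" using j by auto
    then show False using no[of "2 * j - m"] q primitive_rootD[OF assms(1)]
      by (metis power_add mult_1)
  qed
qed

lemma primitive_root_inj:
  assumes "primitive_root m q" "m > 0"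
  shows "inj_on (\<lambda>i. q ^ i) {..<m}"
proof -
  have nz: "q \<noteq> 0" using assms by (rule primitive_root_nonzero)
  have "i = j" if "i \<le> j" "j < m" "q ^ i = q ^ j" for i j
  proof (rule ccontr)
    assume "i \<noteq> j"
    have "q ^ j = q ^ i * q ^ (j - i)" using that(1) by (simp flip: power_add)
    then have "q ^ (j - i) = 1" using that(3) nz by simp
    moreover have "0 < j - i" "j - i < m" using that \<open>i \<noteq> j\<close> by auto
    ultimately show False using assms(1) by (simp add: primitive_root_def)
  qed
  then show ?thesis by (metis inj_onI lessThan_iff linorder_linear)
qed

text \<open>The values are those of a polynomial of degree less than \<open>m\<close> at
  \<open>m\<close> distinct points.\<close>

lemma fourier_injective:
  fixes \<psi> :: "nat \<Rightarrow> complex"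
  assumes "primitive_root m q" "m > 0" "\<And>i. i < m \<Longrightarrow> (\<Sum>k<m. \<psi> k * (q ^ i) ^ k) = 0" "k < m"
  shows "\<psi> k = 0"
proof -
  define p where "p = (\<Sum>k<m. monom (\<psi> k) k)"
  have "degree p \<le> m - 1"
    unfolding p_def by (intro degree_sum_le) (auto intro: order_trans[OF degree_monom_le])
  then have d: "degree p < m" using assms(2) by linarith
  have "p = 0"
  proof (rule poly_eqI_degree[of "(\<lambda>i. q ^ i) ` {..<m}"])
    fix x assume "x \<in> (\<lambda>i. q ^ i) ` {..<m}"
    then show "poly p x = poly 0 x" using assms(3) by (auto simp: p_def poly_sum poly_monom)
  qed (use d assms(2) in \<open>simp_all add: card_image[OF primitive_root_inj[OF assms(1,2)]]\<close>)
  moreover have "coeff p k = \<psi> k" using assms(4) by (simp add: p_def coeff_sum if_distrib cong: if_cong)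
  ultimately show ?thesis by simp
qed

text \<open>
  A discrete Fourier transform with the Gaussian kernel \<open>e\<close> below carries the recurrence of \<open>S\<^sub>1\<close> to
  that of a Rogers--Ramanujan continued fraction, whose period has trace \<open>1\<close>. A multiplier \<open>\<rho>\<close>
  there corresponds to the multiplier \<open>\<mu> = \<rho> + 1\<close> here.
\<close>

lemma S1_solution:
  fixes \<mu> :: real
  assumes Q: "primitive_root m Q" "odd m" "m \<ge> 3" and \<mu>: "\<mu> > 0" "\<mu> \<noteq> 1" "\<mu>\<^sup>2 - 4 * \<mu> + 2 = 0"
  obtains G where "\<And>n. G (Suc (Suc n)) = G (Suc n) + S1_numer Q (Suc n) * G n"
    "\<And>n. G (n + 2 * m) = of_real \<mu> * G n" "G 0 \<noteq> 0 \<or> G 1 \<noteq> 0"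
proof -
  have "m > 0" using Q(3) by simp
  have Q0: "Q \<noteq> 0" using primitive_root_nonzero[OF Q(1) \<open>m > 0\<close>] .
  have Qm: "Q ^ m = 1" using primitive_rootD[OF Q(1)] .
  \<comment> \<open>This choice makes \<open>y k ^ m = 1 / \<mu>\<close> for every \<open>k\<close>.
    It gives the kernel \<open>e\<close> its multiplier \<open>\<mu>\<close>, and
    \<open>\<mu> \<noteq> 1\<close> keeps \<open>1 - y k\<close> away from zero.\<close>
  define y0 :: complex where "y0 = of_real (root m (1 / \<mu>))"
  have y0: "y0 ^ m = 1 / of_real \<mu>" "y0 \<noteq> 0"
    using \<mu>(1) \<open>m > 0\<close> by (simp_all add: y0_def real_root_pow_pos flip: of_real_power)
  define y where "y k = y0 * Q ^ k" for k
  have y_Suc: "y (Suc k) = Q * y k" for k by (simp add: y_def)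
  have y_per: "y (k + m) = y k" for k by (simp add: y_def power_add Qm)
  have ynz: "y k \<noteq> 0" for k using y0 Q0 by (simp add: y_def)
  have ym: "y k ^ m = 1 / of_real \<mu>" for k
  proof -
    have "(Q ^ k) ^ m = 1" by (metis Qm mult.commute power_mult power_one)
    then show ?thesis by (simp add: y_def power_mult_distrib y0)
  qed
  have y1: "1 - y k \<noteq> 0" for k
  proof
    assume "1 - y k = 0"
    then have "y k = 1" by simp
    then show False using ym[of k] \<mu> by simp
  qed
  \<comment> \<open>The vanishing second summand puts the numerators \<open>inverse (y i)\<close>
    into the form required by \<open>period_trace_roots\<close> and \<open>period_det_roots\<close>,
    with root \<open>inverse Q\<close>.\<close>
  define a where "a = (\<lambda>i. (1 / y0) * inverse Q ^ i + 0 * (1 / y0)\<^sup>2 * inverse Q ^ (2 * i))"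
  have a: "a i = inverse (y i)" for i by (simp add: a_def y_def field_simps)
  define \<rho> where "\<rho> = complex_of_real \<mu> - 1"
  \<comment> \<open>Here the trace is 1 and the determinant is \<open>- \<mu>\<close>; substituting
    \<open>\<rho> = \<mu> - 1\<close> turns the characteristic equation into the quadratic assumed
    for \<open>\<mu>\<close>.\<close>
  have "\<rho>\<^sup>2 - 1 * \<rho> + - ((1 / y0) ^ m) * (1 + (0 * (1 / y0)) ^ m) = of_real (\<mu>\<^sup>2 - 4 * \<mu> + 2)"
    using \<open>m > 0\<close> by (simp add: \<rho>_def power_divide y0 power2_eq_square algebra_simps)
  also have "\<dots> = 0" by (simp only: \<mu>(3) of_real_0)
  finally have "\<rho>\<^sup>2 - period_trace a m * \<rho> + (\<Prod>i = 1..m. - a i) = 0"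
    using Q(3) unfolding a_def
    by (simp only: period_trace_roots[OF primitive_root_inverse[OF Q(1)] Q(2)]
        period_det_roots[OF primitive_root_inverse[OF Q(1)] Q(2)])
  then obtain F where F: "\<And>n. F (Suc (Suc n)) = F (Suc n) + a (Suc n) * F n"
      "\<And>n. F (n + m) = \<rho> * F n" "F 0 \<noteq> 0 \<or> F 1 \<noteq> 0"
    using solution_with_multiplier[of m a \<rho>] Q(3) by (auto simp: a y_per)
  \<comment> \<open>Over one period the weight \<open>p\<close> picks up the factor
    \<open>1 / \<rho>\<close>, cancelling the multiplier of \<open>F\<close>. Thus
    \<open>\<psi>\<close> below is periodic and can be summed cyclically.\<close>
  define p where "p k = (\<Prod>j = 1..k. y j / (1 - y j))" for k
  have "y k \<noteq> 1" for k using y1[of k] by auto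
  then have pnz: "p k \<noteq> 0" for k by (simp add: p_def ynz)
  have p_Suc: "p (Suc k) = p k * (y (Suc k) / (1 - y (Suc k)))" for k by (simp add: p_def)
  have p_per: "p (k + m) = p k / \<rho>" for k
  proof (induction k)
    case 0
    have "(\<Prod>j = 1..m. y j) = y0 ^ m * (\<Prod>j = 1..m. Q ^ j)" by (simp add: y_def prod.distrib)
    also have "\<dots> = 1 / of_real \<mu>" using prod_power_roots[OF Q(1,2)] by (simp add: y0)
    finally have 1: "(\<Prod>j = 1..m. y j) = 1 / of_real \<mu>" .
    have "(\<Prod>j = 1..m. 1 - y j) = (\<Prod>j = 1..m. 1 + (- y0) * Q ^ j)" by (simp add: y_def)
    also have "\<dots> = 1 + (- y0) ^ m" by (rule prod_one_plus_roots[OF Q(1,2)])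
    also have "\<dots> = 1 - 1 / of_real \<mu>" using Q(2) by (simp add: y0)
    finally have 2: "(\<Prod>j = 1..m. 1 - y j) = 1 - 1 / of_real \<mu>" .
    have "p m = (1 / of_real \<mu>) / (1 - 1 / of_real \<mu>)"
      using 1 2 by (simp add: p_def prod_dividef)
    also have "\<dots> = 1 / \<rho>" using \<mu> by (simp add: \<rho>_def field_simps)
    finally show ?case by (simp add: p_def)
  next
    case (Suc k)
    then show ?case using y_per[of "Suc k"] by (simp add: p_Suc)
  qed
  have \<rho>0: "\<rho> \<noteq> 0" using \<mu>(2) by (simp add: \<rho>_def)
  define \<psi> where "\<psi> k = F k * p k / y k" for k
  have \<psi>_per: "\<psi> (k + m) = \<psi> k" for k using \<rho>0 by (simp add: \<psi>_def F(2) p_per y_per)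
  \<comment> \<open>The inner bracket is \<open>\<phi> (Suc k)\<close> for the \<open>\<phi>\<close>
    defined below. The second-order recurrence thus splits into two first-order relations, one for
    each parity in the recurrence of \<open>S\<^sub>1\<close>.\<close>
  have \<psi>_rec: "(\<psi> (Suc (Suc k)) * (1 - y (Suc (Suc k))) - \<psi> (Suc k) * y (Suc k)) * (1 - y (Suc k)) = \<psi> k * y k" for k
  proof -
    have "\<psi> (Suc (Suc k)) * (1 - y (Suc (Suc k))) * (1 - y (Suc k)) = F (Suc (Suc k)) * p k * y (Suc k)"
      unfolding \<psi>_def p_Suc using ynz[of "Suc (Suc k)"] y1[of "Suc (Suc k)"] y1[of "Suc k"] by simp
    moreover have "\<psi> (Suc k) * y (Suc k) * (1 - y (Suc k)) = F (Suc k) * p k * y (Suc k)"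
      unfolding \<psi>_def p_Suc using ynz[of "Suc k"] y1[of "Suc k"] by simp
    moreover have "\<psi> k * y k = F k * p k" unfolding \<psi>_def using ynz[of k] by simp
    moreover have "F (Suc (Suc k)) * y (Suc k) = F (Suc k) * y (Suc k) + F k"
      using ynz[of "Suc k"] by (simp add: F(1) a field_simps)
    ultimately show ?thesis by algebra
  qed
  \<comment> \<open>The exponent \<open>i * Suc i\<close> is chosen so that
    \<open>y k * e (Suc i)\<close>, taken at \<open>k\<close>, \<open>Suc k\<close> and
    \<open>Suc (Suc k)\<close>, equals \<open>e i k\<close> times Q^(2i+2), Q^(i+1) and 1. These
    weights build the numerators of \<open>S\<^sub>1\<close>.\<close>
  define e where "e i k = inverse (y k) ^ i * Q ^ (i * Suc i)" for i k
  have e_per: "e i (k + m) = e i k" for i k by (simp add: e_def y_per)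
  have e0: "y k * e (Suc i) k = Q ^ (2 * Suc i) * e i k" for i k
  proof -
    have "Suc i * Suc (Suc i) = 2 * Suc i + i * Suc i" by simp
    then have "Q ^ (Suc i * Suc (Suc i)) = Q ^ (2 * Suc i) * Q ^ (i * Suc i)" by (metis power_add)
    moreover have "y k * inverse (y k) = 1" using ynz[of k] by simp
    ultimately show ?thesis unfolding e_def power_Suc[of "inverse (y k)"]
      by (metis mult.assoc mult.left_commute mult_1)
  qed
  have e_Suc: "Q ^ i * e i (Suc k) = e i k" for i k
    using Q0 by (simp add: e_def y_Suc power_mult_distrib power_inverse)
  have e1: "y k * e (Suc i) (Suc k) = Q ^ Suc i * e i k" for i k
  proof -
    have "Q ^ Suc i * (y k * e (Suc i) (Suc k)) = Q ^ Suc i * (Q ^ Suc i * e i k)"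
      using e0[of k i] e_Suc[of "Suc i" k] by (simp add: mult_2 mult_2_right power_add mult_ac)
    then show ?thesis using Q0 by simp
  qed
  have e2: "y k * e (Suc i) (Suc (Suc k)) = e i k" for i k
  proof -
    have "Q ^ Suc i * (y k * e (Suc i) (Suc (Suc k))) = Q ^ Suc i * e i k"
      using e1[of k i] e_Suc[of "Suc i" "Suc k"] by (simp add: mult_ac)
    then show ?thesis using Q0 by simp
  qed
  have e3: "Q ^ Suc (2 * i) * e i (Suc k) = y k * e (Suc i) (Suc k)" for i k
  proof -
    have "Q * (Q ^ Suc (2 * i) * e i (Suc k)) = Q * (y k * e (Suc i) (Suc k))"
      using e0[of "Suc k" i] by (auto simp: y_Suc mult_ac)
    then show ?thesis using Q0 by simp
  qed
  have e_mult: "e (i + m) k = of_real \<mu> * e i k" for i k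
  proof -
    have "(i + m) * Suc (i + m) = i * Suc i + m * (2 * i + m + 1)" by (simp add: algebra_simps)
    then have "Q ^ ((i + m) * Suc (i + m)) = Q ^ (i * Suc i) * (Q ^ m) ^ (2 * i + m + 1)"
      by (metis power_add power_mult)
    moreover have "inverse (y k) ^ m = of_real \<mu>" by (simp add: power_inverse ym)
    ultimately show ?thesis by (simp add: e_def power_add Qm)
  qed
  define \<phi> where "\<phi> k = \<psi> (Suc k) * (1 - y (Suc k)) - \<psi> k * y k" for k
  have \<phi>_per: "\<phi> (k + m) = \<phi> k" for k
    using \<psi>_per[of "Suc k"] y_per[of "Suc k"] by (simp add: \<phi>_def \<psi>_per y_per)
  define E D where "E i = (\<Sum>k<m. \<psi> k * e i k)" and "D i = (\<Sum>k<m. \<phi> k * e i (Suc k))" for i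
  have E_rec: "E (Suc i) = D (Suc i) + (Q ^ Suc i + Q ^ (2 * Suc i)) * E i" for i
  proof -
    have "(\<Sum>k<m. \<psi> (Suc k) * (1 - y (Suc k)) * e (Suc i) (Suc k)) = (\<Sum>k<m. \<psi> k * (1 - y k) * e (Suc i) k)"
      by (rule sum_cyclic_shift) (simp add: \<psi>_per y_per e_per)
    then have "D (Suc i) = (\<Sum>k<m. \<psi> k * (1 - y k) * e (Suc i) k) - (\<Sum>k<m. \<psi> k * y k * e (Suc i) (Suc k))"
      by (simp add: D_def \<phi>_def left_diff_distrib sum_subtractf)
    also have "(\<Sum>k<m. \<psi> k * (1 - y k) * e (Suc i) k) = E (Suc i) - (\<Sum>k<m. \<psi> k * (y k * e (Suc i) k))"
      by (simp add: E_def algebra_simps sum_subtractf)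
    also have "(\<Sum>k<m. \<psi> k * (y k * e (Suc i) k)) = Q ^ (2 * Suc i) * E i"
      unfolding e0 by (simp add: E_def sum_distrib_left mult_ac)
    also have "(\<Sum>k<m. \<psi> k * y k * e (Suc i) (Suc k)) = Q ^ Suc i * E i"
      unfolding mult.assoc e1 by (simp add: E_def sum_distrib_left mult_ac)
    finally show ?thesis by (simp add: algebra_simps)
  qed
  have D_rec: "D (Suc i) = E i + Q ^ Suc (2 * i) * D i" for i
  proof -
    have "Q ^ Suc (2 * i) * D i = (\<Sum>k<m. \<phi> k * (Q ^ Suc (2 * i) * e i (Suc k)))"
      by (simp add: D_def sum_distrib_left mult_ac)
    also have "\<dots> = D (Suc i) - (\<Sum>k<m. \<phi> k * (1 - y k) * e (Suc i) (Suc k))"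
      unfolding e3 by (simp add: D_def algebra_simps sum_subtractf)
    also have "(\<Sum>k<m. \<phi> k * (1 - y k) * e (Suc i) (Suc k)) = (\<Sum>k<m. \<phi> (Suc k) * (1 - y (Suc k)) * e (Suc i) (Suc (Suc k)))"
      using e_per[of "Suc i" "Suc _"] by (intro sum_cyclic_shift[symmetric]) (simp add: \<phi>_per y_per)
    also have "\<dots> = (\<Sum>k<m. \<psi> k * (y k * e (Suc i) (Suc (Suc k))))"
      unfolding \<phi>_def \<psi>_rec by (simp add: mult.assoc)
    also have "\<dots> = E i" unfolding e2 E_def ..
    finally show ?thesis by simp
  qed
  define G where "G n = (if even n then D (n div 2) else E (n div 2))" for n
  have G_rec: "G (Suc (Suc n)) = G (Suc n) + S1_numer Q (Suc n) * G n" for n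
  proof (cases "even n")
    case True
    then obtain i where "n = 2 * i" by blast
    then show ?thesis using D_rec[of i] by (simp add: G_def S1_numer_def)
  next
    case False
    then obtain i where "n = Suc (2 * i)" by (metis oddE Suc_eq_plus1)
    then show ?thesis using E_rec[of i] by (simp add: G_def S1_numer_def)
  qed
  have G_mult: "G (n + 2 * m) = of_real \<mu> * G n" for n
    by (auto simp: G_def E_def D_def e_mult sum_distrib_left mult_ac add.commute[of m])
  have "G 0 \<noteq> 0 \<or> G 1 \<noteq> 0"
  proof (rule ccontr)
    assume *: "\<not> ?thesis"
    have "G n = 0" for n
      by (induction n rule: induct_nat_012) (use * in \<open>auto simp: G_rec\<close>)
    from this[of "Suc (2 * i)" for i] have E0: "E i = 0" for i by (simp add: G_def)
    \<comment> \<open>Up to a nonzero factor depending only on \<open>i\<close>, \<open>E i\<close>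
      is a Fourier coefficient of \<open>\<psi>\<close>. If all vanish, so do \<open>\<psi>\<close>
      and the initial values of \<open>F\<close>.\<close>
    have "(\<Sum>k<m. \<psi> k * (inverse Q ^ i) ^ k) = 0" for i
    proof -
      have "E i = inverse y0 ^ i * Q ^ (i * Suc i) * (\<Sum>k<m. \<psi> k * (inverse Q ^ i) ^ k)"
        unfolding E_def sum_distrib_left
        by (intro sum.cong refl) (simp add: e_def y_def power_mult_distrib power_inverse mult_ac flip: power_mult)
      then show ?thesis using E0[of i] y0(2) Q0 by simp
    qed
    then have "\<psi> k = 0" if "k < m" for k
      using fourier_injective[OF primitive_root_inverse[OF Q(1)] \<open>m > 0\<close>] that by blast
    from this[of 0] this[of 1] Q(3) F(3) show False by (simp add: \<psi>_def pnz ynz)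
  qed
  with G_rec G_mult show thesis by (rule that)
qed

text \<open>The assumption covers both roots 2 + sqrt 2 and 2 - sqrt 2, and two distinct roots
  determine a monic quadratic.\<close>

lemma quadratic_eq_from_roots:
  fixes T D :: complex
  assumes "\<And>\<mu> :: real. \<mu> > 0 \<Longrightarrow> \<mu> \<noteq> 1 \<Longrightarrow> \<mu>\<^sup>2 - 4 * \<mu> + 2 = 0 \<Longrightarrow>
      (of_real \<mu>)\<^sup>2 - T * of_real \<mu> + D = 0"
  shows "T = 4 \<and> D = 2"
proof -
  define s where "s = sqrt (2::real)"
  have s: "s * s = 2" "s > 0" by (simp_all add: s_def)
  have "s < 2" "s \<noteq> 1" using s(1) by (auto simp: s_def real_less_lsqrt)
  have 1: "(of_real (2 + s))\<^sup>2 - T * of_real (2 + s) + D = 0"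
    using s by (intro assms) (auto simp: power2_eq_square algebra_simps)
  have 2: "(of_real (2 - s))\<^sup>2 - T * of_real (2 - s) + D = 0"
    using s \<open>s < 2\<close> \<open>s \<noteq> 1\<close> by (intro assms) (auto simp: power2_eq_square algebra_simps)
  have S: "complex_of_real s * of_real s = 2" by (metis s(1) of_real_mult of_real_numeral)
  have "2 * of_real s * (4 - T) = 0" using 1 2 by (simp only: of_real_add of_real_diff of_real_numeral) algebra
  then have "T = 4" using s by simp
  moreover have "D = 2" using 1 S \<open>T = 4\<close> by (simp add: power2_eq_square algebra_simps)
  ultimately show ?thesis by simp
qed

lemma S1_period:
  assumes Q: "primitive_root m Q" "odd m" "m \<ge> 3"
  shows "period_trace (S1_numer Q) (2 * m) = 4 \<and> (\<Prod>i = 1..2 * m. - S1_numer Q i) = 2"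
proof (rule quadratic_eq_from_roots)
  fix \<mu> :: real
  assume "\<mu> > 0" "\<mu> \<noteq> 1" "\<mu>\<^sup>2 - 4 * \<mu> + 2 = 0"
  from S1_solution[OF Q this] obtain G where G:
    "\<And>n. G (Suc (Suc n)) = G (Suc n) + S1_numer Q (Suc n) * G n"
    "\<And>n. G (n + 2 * m) = of_real \<mu> * G n" "G 0 \<noteq> 0 \<or> G 1 \<noteq> 0" by metis
  show "(of_real \<mu>)\<^sup>2 - period_trace (S1_numer Q) (2 * m) * of_real \<mu> + (\<Prod>i = 1..2 * m. - S1_numer Q i) = 0"
    using G(2)[of 0] G(2)[of 1] Q(3)
    by (intro multiplier_char_eq[of G "S1_numer Q", OF G(1) _ _ _ G(3)]) auto
qed

text \<open>Adding the odd number \<open>m\<close> swaps the parities of the indices while leaving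
  powers of \<open>q\<close> unchanged.\<close>

lemma S2_numer_eq_S1_numer:
  assumes "q ^ m = 1" "odd m"
  shows "S2_numer q n = S1_numer (q\<^sup>2) (n + m)"
proof -
  have "(q\<^sup>2) ^ m = 1" using assms(1) by (metis power_mult mult.commute power_one)
  moreover have "(q\<^sup>2) ^ ((n + m) div 2) = q ^ n" if "odd n"
  proof -
    have "2 * ((n + m) div 2) = n + m" using that assms(2) by simp
    then show ?thesis using assms(1) by (simp add: power_add flip: power_mult)
  qed
  ultimately show ?thesis using assms(2)
    by (auto simp: S1_numer_def S2_numer_def power_add simp flip: power_mult)
qed

lemma S2_period:
  assumes q: "primitive_root m q" "odd m" "m \<ge> 3"
  shows "period_trace (S2_numer q) (2 * m) = 4 \<and> (\<Prod>i = 1..2 * m. - S2_numer q i) = 2"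
proof (rule quadratic_eq_from_roots)
  fix \<mu> :: real
  assume \<mu>: "\<mu> > 0" "\<mu> \<noteq> 1" "\<mu>\<^sup>2 - 4 * \<mu> + 2 = 0"
  from S1_solution[OF primitive_root_square[OF q(1,2)] q(2,3) \<mu>] obtain G where G:
    "\<And>n. G (Suc (Suc n)) = G (Suc n) + S1_numer (q\<^sup>2) (Suc n) * G n"
    "\<And>n. G (n + 2 * m) = of_real \<mu> * G n" "G 0 \<noteq> 0 \<or> G 1 \<noteq> 0" by metis
  define H where "H n = G (n + m)" for n
  have H: "H (Suc (Suc n)) = H (Suc n) + S2_numer q (Suc n) * H n" for n
    using G(1)[of "n + m"] by (simp add: H_def S2_numer_eq_S1_numer[OF primitive_rootD[OF q(1)] q(2)])
  \<comment> \<open>If \<open>H\<close> vanished identically, \<open>G\<close> would vanish at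
    \<open>2 * m\<close> and \<open>2 * m + 1\<close>, where its values are \<open>\<mu>\<close>
    times the initial ones.\<close>
  have nz: "H 0 \<noteq> 0 \<or> H 1 \<noteq> 0"
  proof (rule ccontr)
    assume *: "\<not> ?thesis"
    have "H n = 0" for n
      by (induction n rule: induct_nat_012) (use * in \<open>auto simp: H\<close>)
    then have "G (2 * m) = 0" "G (1 + 2 * m) = 0"
      unfolding H_def by (metis mult_2, metis add.assoc mult_2)
    then show False using G(2)[of 0] G(2)[of 1] G(3) \<mu>(1) by simp
  qed
  show "(of_real \<mu>)\<^sup>2 - period_trace (S2_numer q) (2 * m) * of_real \<mu> + (\<Prod>i = 1..2 * m. - S2_numer q i) = 0"
    using G(2)[of m] G(2)[of "Suc m"] q(3)
    by (intro multiplier_char_eq[of H "S2_numer q", OF H _ _ _ nz]) (auto simp: H_def add_ac)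
qed

subsection \<open>Generic points of the unit circle\<close>

lemma primitive_root_cis:
  fixes k :: int
  assumes "prime m" "\<not> int m dvd k"
  shows "primitive_root m (cis (2 * pi * k / m))"
  unfolding primitive_root_def
proof (intro conjI allI impI notI)
  have m: "m > 0" using assms(1) by (rule prime_gt_0_nat)
  have "real m * (2 * pi * k / m) = 2 * pi * of_int k" using m by simp
  then have "cis (2 * pi * k / m) ^ m = cis (2 * pi * of_int k)" by (simp only: Complex.DeMoivre)
  then show "cis (2 * pi * k / m) ^ m = 1" by (simp only: cis_multiple_2pi[OF Ints_of_int])
  fix j assume j: "0 < j \<and> j < m" "cis (2 * pi * k / m) ^ j = 1"
  then have "cos (real j * (2 * pi * k / m)) = 1" by (simp add: Complex.DeMoivre complex_eq_iff)
  then obtain n :: int where "real j * (2 * pi * k / m) = of_int n * 2 * pi"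
    by (auto simp: cos_one_2pi_int)
  then have "of_int (int j * k) = (of_int (n * int m) :: real)" using m by (simp add: field_simps)
  then have "int j * k = n * int m" by (simp only: of_int_eq_iff)
  then have "int m dvd int j * k" by simp
  then have "int m dvd int j" using assms by (auto simp: prime_dvd_mult_iff)
  then show False using j(1) by (auto dest: dvd_imp_le)
qed

text \<open>Fractions with a large prime denominator \<open>m\<close> approximate the angle within
  one step, and primality makes the root primitive as soon as \<open>m\<close> does not divide the
  numerator.\<close>

lemma primitive_roots_dense:
  assumes "norm x = 1" "e > 0"
  obtains m q where "primitive_root m q" "odd m" "m \<ge> 3" "m \<ge> N" "norm q = 1" "dist q x < e"
proof -
  define t where "t = Arg x"
  have "x \<noteq> 0" using assms(1) by auto
  then have x: "x = cis t" using assms(1) by (simp add: t_def cis_Arg sgn_eq)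
  have t: "- pi < t" "t \<le> pi" using Arg_bounded[of x] by (auto simp: t_def)
  have "isCont cis t" by (simp add: cis_conv_exp[abs_def])
  then obtain d where d: "d > 0" "\<And>s. dist s t < d \<Longrightarrow> dist (cis s) (cis t) < e"
    using assms(2) unfolding continuous_at_eps_delta by metis
  obtain m where m: "prime m" "m > N + 3 + nat \<lceil>2 * pi / d\<rceil>" using bigger_prime by blast
  then have "real m > 2 * pi / d" by linarith
  then have md: "2 * pi / m < d" using d(1) m(2) by (simp add: field_simps)
  define k0 where "k0 = \<lfloor>real m * (t / (2 * pi))\<rfloor>"
  \<comment> \<open>The numerator 0 would give the root 1, which is not primitive; replacing it by 1
    keeps the error at most one step.\<close>
  define k where "k = (if k0 = 0 then 1 else k0)"
  have tb: "- (1/2) \<le> t / (2 * pi)" "t / (2 * pi) \<le> 1/2" using t by (simp_all add: field_simps)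
  have "real m * (- (1/2)) \<le> real m * (t / (2 * pi))" "real m * (t / (2 * pi)) \<le> real m * (1/2)"
    using tb by (intro mult_left_mono; simp)+
  then have "real_of_int k0 \<le> real m * (1/2)" "real m * (- (1/2)) - 1 \<le> real_of_int k0"
    unfolding k0_def by linarith+
  moreover have "real m > 3" using m(2) by linarith
  ultimately have "\<bar>real_of_int k\<bar> < real m" unfolding k_def by (cases "k0 = 0") auto
  then have "\<bar>k\<bar> < int m" by linarith
  moreover have "k \<noteq> 0" by (simp add: k_def)
  ultimately have nd: "\<not> int m dvd k" using zdvd_imp_le[of "int m" "\<bar>k\<bar>"] by auto
  have "\<bar>of_int k - real m * (t / (2 * pi))\<bar> \<le> 1" unfolding k_def k0_def by (simp; linarith)
  then have "(2 * pi / m) * \<bar>of_int k - real m * (t / (2 * pi))\<bar> \<le> 2 * pi / m * 1"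
    by (intro mult_left_mono) auto
  also have "(2 * pi / m) * \<bar>of_int k - real m * (t / (2 * pi))\<bar> = \<bar>(2 * pi / m) * (of_int k - real m * (t / (2 * pi)))\<bar>"
    by (simp add: abs_mult)
  also have "(2 * pi / m) * (of_int k - real m * (t / (2 * pi))) = 2 * pi * k / m - t"
    using m(2) by (simp add: field_simps)
  finally have "dist (2 * pi * k / m) t < d" using md by (simp add: dist_real_def)
  then have "dist (cis (2 * pi * k / m)) x < e" unfolding x by (rule d(2))
  then show thesis
    using that[of m "cis (2 * pi * k / m)"] primitive_root_cis[OF m(1) nd] m prime_odd_nat[of m] by simp
qed

text \<open>If \<open>X\<close> were countable, the complements of its points could join the dense
  open sets \<open>U N\<close> in a countable family. Its intersection is empty, contradicting
  Baire's theorem on the circle.\<close>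

lemma uncountable_generic:
  fixes P :: "nat \<Rightarrow> complex \<Rightarrow> bool"
  assumes "\<And>n. open {q. P n q}"
    and "\<And>m q. primitive_root m q \<Longrightarrow> odd m \<Longrightarrow> m \<ge> 3 \<Longrightarrow> \<exists>n\<ge>m - 1. P n q"
  shows "uncountable {q. norm q = 1 \<and> (\<forall>N. \<exists>n\<ge>N. P n q)}"
proof
  define X where "X = {q. norm q = 1 \<and> (\<forall>N. \<exists>n\<ge>N. P n q)}"
  assume "countable {q. norm q = 1 \<and> (\<forall>N. \<exists>n\<ge>N. P n q)}"
  then have X: "countable X" by (simp add: X_def)
  define S where "S = sphere (0::complex) 1"
  define U where "U N = S \<inter> (\<Union>n\<in>{N..}. {q. P n q})" for N
  define \<G> where "\<G> = range U \<union> (\<lambda>x. S - {x}) ` X"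
  have "S \<subseteq> closure (\<Inter>\<G>)"
  proof (rule Baire)
    show "closed S" by (simp add: S_def)
    show "countable \<G>" using X by (simp add: \<G>_def)
    fix T assume "T \<in> \<G>"
    then consider N where "T = U N" | x where "x \<in> X" "T = S - {x}" unfolding \<G>_def by blast
    then show "openin (top_of_set S) T \<and> S \<subseteq> closure T"
    proof cases
      case (1 N)
      have "open (\<Union>n\<in>{N..}. {q. P n q})" using assms(1) by blast
      then have "openin (top_of_set S) T" unfolding 1 U_def by (rule openin_open_Int)
      moreover have "S \<subseteq> closure T"
        unfolding closure_approachable subset_iff
      proof (intro allI impI)
        fix x and e :: real
        assume "x \<in> S" "e > 0"
        \<comment> \<open>Requiring \<open>m \<ge> Suc N\<close> ensures that the index
          \<open>n \<ge> m - 1\<close> attached to the root is at least \<open>N\<close>.\<close>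
        then obtain m q where mq: "primitive_root m q" "odd m" "m \<ge> 3" "m \<ge> Suc N" "norm q = 1" "dist q x < e"
          using primitive_roots_dense[of x e "Suc N"] by (auto simp: S_def)
        then obtain n where "n \<ge> m - 1" "P n q" using assms(2) by blast
        then have "q \<in> T" using mq by (auto simp: 1 U_def S_def)
        then show "\<exists>y\<in>T. dist y x < e" using mq by blast
      qed
      ultimately show ?thesis ..
    next
      case (2 x)
      \<comment> \<open>A connected set with more than one point has no isolated points, so deleting
        a point leaves it dense.\<close>
      have "connected S" unfolding S_def by (rule connected_sphere) simp
      moreover have "S \<noteq> {z}" for z
      proof
        assume "S = {z}"
        moreover have "1 \<in> S" "-1 \<in> S" by (simp_all add: S_def)
        ultimately show False by auto
      qed
      ultimately have "y islimpt S" if "y \<in> S" for y using that connected_imp_perfect by blast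
      then have "S \<subseteq> closure T"
        unfolding 2 closure_def by (metis (no_types, lifting) DiffI UnI1 UnI2 islimpt_punctured mem_Collect_eq singletonD subsetI)
      moreover have "openin (top_of_set S) T" unfolding 2 by (simp add: openin_delete)
      ultimately show ?thesis by blast
    qed
  qed
  moreover have "\<Inter>\<G> = {}"
  proof (rule ccontr)
    assume "\<Inter>\<G> \<noteq> {}"
    then obtain q where q: "q \<in> \<Inter>\<G>" by blast
    then have "q \<in> U N" for N by (auto simp: \<G>_def)
    then have "q \<in> X" unfolding X_def U_def S_def by (auto; blast)
    then show False using q by (auto simp: \<G>_def)
  qed
  moreover have "1 \<in> S" by (simp add: S_def)
  ultimately show False by auto
qed

text \<open>Strict inequalities with room to spare, 10 against 9 and 1/2 against 1, make this an
  open condition on \<open>q\<close> that holds at the roots of unity themselves.\<close>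

definition bounded_approximant :: "(nat \<Rightarrow> complex) \<Rightarrow> nat \<Rightarrow> bool" where
  "bounded_approximant a n \<longleftrightarrow>
    norm (cf_num (\<lambda>_. 1) a (Suc n)) < 10 \<and> norm (cf_num (\<lambda>_. 1) a n) < 10 \<and>
    norm (cf_den (\<lambda>_. 1) a (Suc n)) < 10 \<and> norm (cf_den (\<lambda>_. 1) a n) < 10 \<and>
    1 / 2 < norm (cf_num (\<lambda>_. 1) a (Suc n) * cf_den (\<lambda>_. 1) a n - cf_num (\<lambda>_. 1) a n * cf_den (\<lambda>_. 1) a (Suc n))"

section \<open>Bounded approximants at and near roots of unity\<close>

lemma continuous_on_cf_num:
  assumes "\<And>n. continuous_on S (\<lambda>q. a q n)"
  shows "continuous_on S (\<lambda>q. cf_num (\<lambda>_. 1) (a q) n)"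
  by (induction n rule: induct_nat_012) (auto intro!: continuous_intros assms)

lemma continuous_on_cf_den:
  assumes "\<And>n. continuous_on S (\<lambda>q. a q n)"
  shows "continuous_on S (\<lambda>q. cf_den (\<lambda>_. 1) (a q) n)"
  by (induction n rule: induct_nat_012) (auto intro!: continuous_intros assms)

lemma open_bounded_approximant:
  fixes a :: "complex \<Rightarrow> nat \<Rightarrow> complex"
  assumes "\<And>n. continuous_on UNIV (\<lambda>q. a q n)"
  shows "open {q. bounded_approximant (a q) n}"
  unfolding bounded_approximant_def
  by (intro open_Collect_conj open_Collect_less continuous_intros continuous_on_cf_num continuous_on_cf_den assms)

lemma bounded_approximant_at_period:
  fixes a :: "nat \<Rightarrow> complex" and c \<tau> \<delta> :: real
  assumes "L \<ge> 3" "\<And>n. 0 < n \<Longrightarrow> n < L \<Longrightarrow> a (L - n) = cnj (a n)"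
    and "a L = of_real c" "1 \<le> c" "period_trace a L = of_real \<tau>" "\<bar>\<tau>\<bar> \<le> 4"
    and "(\<Prod>i = 1..L. - a i) = of_real \<delta>" "c \<le> \<bar>\<delta>\<bar>" "\<bar>\<delta>\<bar> \<le> 2"
  shows "bounded_approximant a (L - 1)"
proof -
  obtain k where k: "L = Suc (Suc k)"
    using assms(1) by (intro that[of "L - 2"]) simp
  from period_bounded[OF assms] show ?thesis
    unfolding bounded_approximant_def cf_wronskian
    by (simp add: k cf_num_eq_continuant cf_den_eq_continuant del: continuant.simps cf_num.simps cf_den.simps)
qed

lemma primitive_root_norm:
  assumes "primitive_root m q" "m > 0"
  shows "norm q = 1"
proof -
  have "norm q ^ m = 1" using primitive_rootD[OF assms(1)] by (metis norm_one norm_power)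
  then show ?thesis using assms(2) by (metis norm_ge_zero power_eq_imp_eq_base power_one zero_le_one)
qed

lemma unit_power_diff:
  fixes q :: complex
  assumes "norm q = 1" "q ^ L = 1" "n \<le> L"
  shows "q ^ (L - n) = cnj (q ^ n)"
proof -
  have "q ^ n * cnj (q ^ n) = 1"
    by (simp only: complex_norm_square[symmetric] norm_power assms(1)) simp
  moreover have "q ^ n * q ^ (L - n) = 1" using assms(2,3) by (simp flip: power_add)
  moreover have "q ^ n \<noteq> 0" using assms(1) by auto
  ultimately show ?thesis using mult_left_cancel by metis
qed

lemma bounded_approximant_at_root:
  assumes q: "primitive_root m q" "odd m" "m \<ge> 3" and a: "a \<in> {K_numer, S1_numer, S2_numer, S3_numer}"
  shows "\<exists>n\<ge>m - 1. bounded_approximant (a q) n"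
proof -
  have qm: "q ^ m = 1" by (rule primitive_rootD[OF q(1)])
  have nq: "norm q = 1" using primitive_root_norm[OF q(1)] q(3) by simp
  have cm: "q ^ (m - n) = cnj (q ^ n)" if "n \<le> m" for n by (rule unit_power_diff[OF nq qm that])
  have q2m: "q ^ (2 * m) = 1" using qm by (simp add: mult_2 power_add)
  have c2m: "q ^ (2 * m - n) = cnj (q ^ n)" if "n \<le> 2 * m" for n by (rule unit_power_diff[OF nq q2m that])
  have c2: "q ^ (2 * (L - n)) = cnj (q ^ (2 * n))" if "n \<le> L" "q ^ (L - n) = cnj (q ^ n)" for n L
    unfolding mult_2 power_add that(2) by simp
  \<comment> \<open>Both belong to the family of \<open>period_trace_roots\<close> at z = 1, with c
    = 0 and c = 1.\<close>
  have S: "K_numer q = (\<lambda>i. 1 * q ^ i + 0 * 1\<^sup>2 * q ^ (2 * i))" "S3_numer q = (\<lambda>i. 1 * q ^ i + 1 * 1\<^sup>2 * q ^ (2 * i))"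
    by (simp_all add: K_numer_def[abs_def] S3_numer_def[abs_def] fun_eq_iff)
  have tr: "period_trace (K_numer q) m = 1" "period_trace (S3_numer q) m = 1"
    unfolding S using q by (intro period_trace_roots; simp)+
  have "(\<Prod>i = 1..m. - K_numer q i) = - (1 ^ m) * (1 + (0 * 1) ^ m)"
    unfolding S by (rule period_det_roots[OF q(1,2)])
  then have detK: "(\<Prod>i = 1..m. - K_numer q i) = - 1" using q(3) by simp
  have "(\<Prod>i = 1..m. - S3_numer q i) = - (1 ^ m) * (1 + (1 * 1) ^ m)"
    unfolding S by (rule period_det_roots[OF q(1,2)])
  then have detS3: "(\<Prod>i = 1..m. - S3_numer q i) = - 2" by simp
  from a consider "a = K_numer" | "a = S1_numer" | "a = S2_numer" | "a = S3_numer" by blast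
  then show ?thesis
  proof cases
    case 1
    have "bounded_approximant (K_numer q) (m - 1)"
      by (rule bounded_approximant_at_period[where c = 1 and \<tau> = 1 and \<delta> = "-1"])
        (use q tr detK in \<open>simp_all add: K_numer_def cm qm\<close>)
    then show ?thesis using 1 by blast
  next
    case 2
    \<comment> \<open>The period doubles because the numerators depend on the parity of the index
      while \<open>m\<close> is odd. The value \<open>c = 2\<close> is the last numerator q^m +
      q^(2m).\<close>
    have "bounded_approximant (S1_numer q) (2 * m - 1)"
    proof (rule bounded_approximant_at_period[where c = 2 and \<tau> = 4 and \<delta> = 2])
      fix n assume n: "0 < n" "n < 2 * m"
      show "S1_numer q (2 * m - n) = cnj (S1_numer q n)"
      proof (cases "even n")
        case True
        then obtain i where "n = 2 * i" by blast
        \<comment> \<open>For \<open>n = 2 * i\<close> the halved exponent reflects to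
          \<open>m - i\<close>, so the symmetry is needed within \<open>m\<close> rather than
          \<open>2 * m\<close>.\<close>
        then show ?thesis using n cm[of i] c2[of i m] by (simp add: S1_numer_def flip: diff_mult_distrib2)
      next
        case False
        then show ?thesis using n c2m[of n] by (simp add: S1_numer_def)
      qed
    qed (use q S1_period[OF q] in \<open>simp_all add: S1_numer_def qm q2m\<close>)
    moreover have "2 * m - 1 \<ge> m - 1" by simp
    ultimately show ?thesis using 2 by blast
  next
    case 3
    have "bounded_approximant (S2_numer q) (2 * m - 1)"
    proof (rule bounded_approximant_at_period[where c = 1 and \<tau> = 4 and \<delta> = 2])
      fix n assume n: "0 < n" "n < 2 * m"
      then show "S2_numer q (2 * m - n) = cnj (S2_numer q n)"
        using c2m[of n] c2[of n "2 * m"] by (simp add: S2_numer_def)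
    next
      have "q ^ (2 * (2 * m)) = q ^ (2 * m) * q ^ (2 * m)" by (simp only: mult_2[of "2 * m"] power_add)
      then show "S2_numer q (2 * m) = complex_of_real 1" unfolding S2_numer_def q2m by simp
    qed (use q S2_period[OF q] in simp_all)
    moreover have "2 * m - 1 \<ge> m - 1" by simp
    ultimately show ?thesis using 3 by blast
  next
    case 4
    have "bounded_approximant (S3_numer q) (m - 1)"
      by (rule bounded_approximant_at_period[where c = 2 and \<tau> = 1 and \<delta> = "-2"])
        (use q tr detS3 in \<open>simp_all add: S3_numer_def cm c2 qm q2m\<close>)
    then show ?thesis using 4 by blast
  qed
qed

theorem corollary2:
  "\<forall>a \<in> {K_numer, S1_numer, S2_numer, S3_numer}.
     \<exists>X :: complex set. uncountable X \<and> X \<subseteq> {q. norm q = 1} \<and>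
       (\<forall>q \<in> X. \<not> converges_generally (\<lambda>n. 1) (a q))"
proof
  fix a assume a: "a \<in> {K_numer, S1_numer, S2_numer, S3_numer}"
  define X where "X = {q. norm q = 1 \<and> (\<forall>N. \<exists>n\<ge>N. bounded_approximant (a q) n)}"
  have "continuous_on UNIV (\<lambda>q. a q n)" for n
    using a by (cases "odd n")
      (auto simp: K_numer_def S1_numer_def S2_numer_def S3_numer_def intro!: continuous_intros)
  then have "uncountable X"
    unfolding X_def using a
    by (intro uncountable_generic open_bounded_approximant bounded_approximant_at_root)
  moreover have "\<not> converges_generally (\<lambda>n. 1) (a q)" if "q \<in> X" for q
  proof (rule not_converges_generally[where c = "1 / 2" and C = 10])
    show "\<exists>n\<ge>N. norm (cf_num (\<lambda>_. 1) (a q) (Suc n)) \<le> 10 \<and> norm (cf_num (\<lambda>_. 1) (a q) n) \<le> 10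
      \<and> norm (cf_den (\<lambda>_. 1) (a q) (Suc n)) \<le> 10 \<and> norm (cf_den (\<lambda>_. 1) (a q) n) \<le> 10
      \<and> 1 / 2 \<le> norm (cf_num (\<lambda>_. 1) (a q) (Suc n) * cf_den (\<lambda>_. 1) (a q) n
          - cf_num (\<lambda>_. 1) (a q) n * cf_den (\<lambda>_. 1) (a q) (Suc n))" for N
      using that unfolding X_def bounded_approximant_def by (blast intro: less_imp_le)
  qed simp
  ultimately show "\<exists>X. uncountable X \<and> X \<subseteq> {q. norm q = 1} \<and> (\<forall>q\<in>X. \<not> converges_generally (\<lambda>n. 1) (a q))"
    by (intro exI[of _ X]) (auto simp: X_def)
qed

end
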